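(* Let $\boldsymbol\rho$ be a pure state on $\mathbb{C}^d$, $y\in\{\pm1\}$, $\gamma>1$, and let $\mathbf{M}_0$ be a Pauli measurement on $\mathbb{C}^d$. Let $\mathbf{M}(t)$, $t\ge0$, be the solution of the one-sample asymptotic ($p\to\infty$) training dynamics with scaling factor $\gamma$, $$\frac{d\mathbf{M}(t)}{dt}=r(t)\,\big[\mathbf{M}(t),[\mathbf{M}(t),\boldsymbol\rho]\big],\qquad r(t)=y-\hat y(t),\qquad \hat y(t)=\operatorname{tr}(\boldsymbol\rho\,\mathbf{M}(t)),$$ with $\mathbf{M}(0)=\gamma\,\mathbf{U}^\dagger\mathbf{M}_0\mathbf{U}$ for some unitary $\mathbf{U}$. If the initial prediction satisfies $|\hat y(0)|<1$, then the objective $L(t)=\frac12(\hat y(t)-y)^2$ converges linearly: there is a constant $C_1\ge\gamma^2-1$ such that $$L(t)\le L(0)\exp(-C_1t)\qquad\text{for all }t\ge0.$$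
   Context: A pure state on $\mathbb{C}^d$ is $\boldsymbol\rho=\mathbf{v}\mathbf{v}^\dagger$ with $\mathbf{v}$ a unit vector. A Pauli measurement is a tensor product of $2\times2$ Pauli matrices ($d$ a power of two); it is a Hermitian matrix with eigenvalues $\pm1$ and trace $0$. $[\mathbf A,\mathbf B]=\mathbf{AB}-\mathbf{BA}$. Origin of the dynamics: a quantum neural network with ansatz $\mathbf{U}(\boldsymbol\theta)=\mathbf{U}_pe^{-i\theta_p\mathbf{H}}\cdots\mathbf{U}_1e^{-i\theta_1\mathbf{H}}\mathbf{U}_0$ ($\mathbf{U}_l$ i.i.d. Haar on $SU(d)$, $\mathbf{H}$ non-zero traceless Hermitian) predicts $\hat y=\gamma\operatorname{tr}(\boldsymbol\rho\,\mathbf{U}(\boldsymbol\theta)^\dagger\mathbf{M}_0\mathbf{U}(\boldsymbol\theta))$, equivalently it uses the measurement $\gamma\mathbf{M}_0$, and is trained on $\frac12(\hat y-y)^2$ by gradient flow with learning rate $\eta=\frac{d^2-1}{p\operatorname{tr}(\mathbf{H}^2)}$. As $p\to\infty$ the scaled parameterized measurement $\mathbf{M}=\gamma\,\mathbf{U}(\boldsymbol\theta)^\dagger\mathbf{M}_0\mathbf{U}(\boldsymbol\theta)$ follows the displayed asymptotic dynamics. *)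

theory Defs
  imports "HOL-Analysis.Analysis"
begin

definition adjoint_mat :: "complex^'n^'m \<Rightarrow> complex^'m^'n" where
  "adjoint_mat A = (\<chi> i j. cnj (A $ j $ i))"

definition unitary_mat :: "complex^'n^'n \<Rightarrow> bool" where
  "unitary_mat U \<longleftrightarrow> adjoint_mat U ** U = mat 1 \<and> U ** adjoint_mat U = mat 1"

definition mat_commutator :: "complex^'n^'n \<Rightarrow> complex^'n^'n \<Rightarrow> complex^'n^'n" where
  "mat_commutator A B = A ** B - B ** A"

definition pure_state :: "complex^'n^'n \<Rightarrow> bool" where
  "pure_state \<rho> \<longleftrightarrow> (\<exists>v :: complex^'n. norm v = 1 \<and> \<rho> = (\<chi> i j. v $ i * cnj (v $ j)))"

definition pauli_X :: "complex^2^2" where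
  "pauli_X = vector [vector [0, 1], vector [1, 0]]"

definition pauli_Y :: "complex^2^2" where
  "pauli_Y = vector [vector [0, - \<i>], vector [\<i>, 0]]"

definition pauli_Z :: "complex^2^2" where
  "pauli_Z = vector [vector [1, 0], vector [0, -1]]"

(* The standard basis of the q-fold tensor power of C^2 is indexed by the functions from the
   q-element type of tensor factors ("qubits") to the two basis labels of C^2, so that
   C^d with d = 2^q is complex^('q => 2). *)
definition tensor_mat :: "('q::finite \<Rightarrow> complex^2^2) \<Rightarrow> complex^('q \<Rightarrow> 2)^('q \<Rightarrow> 2)" where
  "tensor_mat P = (\<chi> i j. \<Prod>k\<in>UNIV. P k $ i k $ j k)"

(* The identity may occur as a tensor factor, but not at every position: the identity on C^d
   has trace d rather than 0. *)
definition pauli_measurement :: "complex^('q::finite \<Rightarrow> 2)^('q \<Rightarrow> 2) \<Rightarrow> bool" where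
  "pauli_measurement M \<longleftrightarrow>
     (\<exists>P. (\<forall>k. P k \<in> {mat 1, pauli_X, pauli_Y, pauli_Z}) \<and> (\<exists>k. P k \<noteq> mat 1)
        \<and> M = tensor_mat P)"

(* tr (rho M) is real for Hermitian rho and M; Re only converts the type. *)
definition prediction :: "complex^'n^'n \<Rightarrow> complex^'n^'n \<Rightarrow> real" where
  "prediction \<rho> M = Re (trace (\<rho> ** M))"

definition objective :: "complex^'n^'n \<Rightarrow> real \<Rightarrow> complex^'n^'n \<Rightarrow> real" where
  "objective \<rho> y M = (prediction \<rho> M - y)\<^sup>2 / 2"

(* M solves dM/dt = r [M, [M, rho]], r = y - tr (rho M), on the time interval [0, infinity);
   the derivative at 0 is one-sided. *)
definition asymptotic_dynamics ::
    "complex^'n^'n \<Rightarrow> real \<Rightarrow> (real \<Rightarrow> complex^'n^'n) \<Rightarrow> bool" where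
  "asymptotic_dynamics \<rho> y M \<longleftrightarrow>
     (\<forall>t\<ge>0. (M has_vector_derivative
         (y - prediction \<rho> (M t)) *\<^sub>R mat_commutator (M t) (mat_commutator (M t) \<rho>))
         (at t within {0..}))"

end

(* Hermiticity of M and the identity M^2 = gamma^2 are preserved by the flow, because M - M^dagger
   and M^2 - gamma^2 solve linear homogeneous equations. For rho = v v^dagger this closes the
   dynamics on the prediction p: since tr (rho M rho M) = p^2, one gets
   p' = 2 (y - p) (gamma^2 - p^2). The prediction then stays in [-1, 1], and
   L' = - 4 (gamma^2 - p^2) L <= - 4 (gamma^2 - 1) L. *)
theory Submission
  imports Defs
begin

section \<open>Linear differential inequalities\<close>

text \<open>Gronwall's inequality by the integrating factor \<open>exp (- k * t)\<close>: it turns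
  \<open>h\<close> into a nonincreasing function. Neither \<open>h\<close> nor \<open>k\<close>
  needs a sign; below, \<open>h\<close> is a negated square, and \<open>k\<close> is negative when
  it is a decay rate.\<close>

lemma differential_inequality_exp:
  fixes h :: "real \<Rightarrow> real"
  assumes T: "0 \<le> T"
    and deriv: "\<And>t. t \<ge> 0 \<Longrightarrow> (h has_real_derivative h' t) (at t within {0..})"
    and le: "\<And>t. 0 \<le> t \<Longrightarrow> t \<le> T \<Longrightarrow> h' t \<le> k * h t"
  shows "h T \<le> h 0 * exp (k * T)"
proof -
  define g where "g t = h t * exp (- k * t)" for t
  have g': "(g has_real_derivative (h' t - k * h t) * exp (- k * t)) (at t within {0..})"
    if "t \<ge> 0" for t
    unfolding g_def using deriv[OF that] by (auto intro!: derivative_eq_intros simp: algebra_simps)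
  have "g T \<le> g 0"
  proof (rule DERIV_nonpos_imp_decreasing_open[of 0 T g, OF T])
    fix t assume t: "0 < t" "t < T"
    \<comment> \<open>The monotonicity rule asks for two-sided derivatives, but only at interior
      points, where the restriction to the half-line has no effect.\<close>
    then have "at t within {0..} = at t"
      by (intro at_within_interior) simp
    moreover have "(h' t - k * h t) * exp (- k * t) \<le> 0"
      using le[of t] t by (simp add: mult_nonpos_nonneg)
    ultimately show "\<exists>y. (g has_real_derivative y) (at t) \<and> y \<le> 0"
      using g'[of t] t by auto
  next
    have "continuous_on {0..} g"
      using g' by (auto intro!: DERIV_continuous_on)
    then show "continuous_on {0..T} g"
      by (rule continuous_on_subset) auto
  qed
  then have "h T * exp (- k * T) * exp (k * T) \<le> h 0 * exp (k * T)"
    by (simp add: g_def)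
  then show ?thesis
    by (simp add: mult.assoc exp_minus)
qed

lemma continuous_on_atLeast_bounded:
  fixes c :: "real \<Rightarrow> real"
  assumes "continuous_on {0..} c"
  obtains C where "\<And>t. 0 \<le> t \<Longrightarrow> t \<le> T \<Longrightarrow> \<bar>c t\<bar> \<le> C"
proof -
  have "continuous_on {0..T} c"
    using assms by (rule continuous_on_subset) auto
  then have "bounded (c ` {0..T})"
    by (intro compact_imp_bounded compact_continuous_image) auto
  then obtain C where "\<forall>t\<in>{0..T}. \<bar>c t\<bar> \<le> C"
    by (auto simp: bounded_iff)
  then show thesis
    by (intro that[of C]) simp
qed

text \<open>Gronwall for the squared norm: with \<open>C\<close> bounding \<open>c\<close> on
  \<open>[0, T]\<close>, Cauchy-Schwarz makes its derivative at most \<open>2 * C\<close> times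
  itself. Asking for a norm bound on \<open>f'\<close> instead of an explicit linear equation lets
  commutator estimates serve directly as input.\<close>

lemma linear_ode_zero:
  fixes f :: "real \<Rightarrow> 'a::real_inner"
  assumes deriv: "\<And>t. t \<ge> 0 \<Longrightarrow> (f has_vector_derivative f' t) (at t within {0..})"
    and bound: "\<And>t. t \<ge> 0 \<Longrightarrow> norm (f' t) \<le> c t * norm (f t)"
    and cont: "continuous_on {0..} c"
    and init: "f 0 = 0"
    and T: "0 \<le> T"
  shows "f T = 0"
proof -
  obtain C where C: "\<And>t. 0 \<le> t \<Longrightarrow> t \<le> T \<Longrightarrow> \<bar>c t\<bar> \<le> C"
    using continuous_on_atLeast_bounded[OF cont] by blast
  have "f T \<bullet> f T \<le> (f 0 \<bullet> f 0) * exp (2 * C * T)"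
  proof (rule differential_inequality_exp[OF T])
    fix t :: real assume "t \<ge> 0"
    from bounded_bilinear.has_vector_derivative[OF bounded_bilinear_inner deriv deriv, OF this this]
    show "((\<lambda>t. f t \<bullet> f t) has_real_derivative 2 * (f t \<bullet> f' t)) (at t within {0..})"
      by (simp add: has_real_derivative_iff_has_vector_derivative inner_commute)
  next
    fix t assume t: "0 \<le> t" "t \<le> T"
    have "f t \<bullet> f' t \<le> norm (f t) * norm (f' t)"
      by (rule norm_cauchy_schwarz)
    also have "\<dots> \<le> norm (f t) * (C * norm (f t))"
    proof (rule mult_left_mono)
      show "norm (f' t) \<le> C * norm (f t)"
        using bound[of t] C[of t] t
        by (meson abs_le_D1 mult_right_mono norm_ge_zero order_trans)
    qed simp
    finally show "2 * (f t \<bullet> f' t) \<le> 2 * C * (f t \<bullet> f t)"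
      by (simp add: power2_norm_eq_inner[symmetric] power2_eq_square ac_simps)
  qed
  then have "f T \<bullet> f T = 0"
    using init inner_ge_zero[of "f T"] by (intro antisym) simp_all
  then show ?thesis
    by simp
qed

text \<open>A solution that starts nonzero never vanishes, because its square decays at most
  exponentially on bounded intervals. A change of sign would force a zero by the intermediate value
  theorem.\<close>

lemma linear_ode_pos:
  fixes z :: "real \<Rightarrow> real"
  assumes deriv: "\<And>t. t \<ge> 0 \<Longrightarrow> (z has_real_derivative c t * z t) (at t within {0..})"
    and cont: "continuous_on {0..} c"
    and init: "z 0 > 0"
    and T: "0 \<le> T"
  shows "z T > 0"
proof -
  have nz: "z S \<noteq> 0" if S: "0 \<le> S" for S
  proof -
    obtain C where C: "\<And>t. 0 \<le> t \<Longrightarrow> t \<le> S \<Longrightarrow> \<bar>c t\<bar> \<le> C"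
      using continuous_on_atLeast_bounded[OF cont] by blast
    \<comment> \<open>Gronwall bounds from above only, so the lower bound on the square comes from
      applying it to the negated square.\<close>
    have "- (z S)\<^sup>2 \<le> - (z 0)\<^sup>2 * exp (- 2 * C * S)"
    proof (rule differential_inequality_exp[OF S])
      fix t :: real assume "t \<ge> 0"
      then show "((\<lambda>t. - (z t)\<^sup>2) has_real_derivative - 2 * c t * (z t)\<^sup>2) (at t within {0..})"
        by (auto intro!: derivative_eq_intros deriv simp: power2_eq_square)
    next
      fix t assume "0 \<le> t" "t \<le> S"
      then have "- c t \<le> C"
        using C[of t] by simp
      then have "- c t * (z t)\<^sup>2 \<le> C * (z t)\<^sup>2"
        by (rule mult_right_mono) simp
      then show "- 2 * c t * (z t)\<^sup>2 \<le> - 2 * C * - (z t)\<^sup>2"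
        by simp
    qed
    moreover have "(z 0)\<^sup>2 * exp (- 2 * C * S) > 0"
      using init by simp
    ultimately show ?thesis
      by auto
  qed
  have "continuous_on {0..} z"
    using deriv by (auto intro!: DERIV_continuous_on)
  then have "continuous_on {0..T} z"
    by (rule continuous_on_subset) auto
  show ?thesis
  proof (rule ccontr)
    assume "\<not> z T > 0"
    then obtain x where "0 \<le> x" "z x = 0"
      using IVT2'[of z T 0 0] \<open>continuous_on {0..T} z\<close> T init by auto
    then show False
      using nz by simp
  qed
qed

section \<open>Matrix algebra\<close>

text \<open>In finite dimension bilinear maps are bounded. This form supplies the product rule,
  continuity and norm estimates for matrix products; bilinearity is over the reals, as time
  derivatives require.\<close>

lemma bounded_bilinear_matrix_matrix_mult:
  "bounded_bilinear ((**) :: complex^'n^'n \<Rightarrow> complex^'n^'n \<Rightarrow> complex^'n^'n)"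
proof -
  have "bilinear ((**) :: complex^'n^'n \<Rightarrow> complex^'n^'n \<Rightarrow> complex^'n^'n)"
    unfolding bilinear_def
  proof (intro conjI allI linearI)
    fix A B C :: "complex^'n^'n" and c :: real
    show "A ** (B + C) = A ** B + A ** C" "(B + C) ** A = B ** A + C ** A"
      by (simp_all add: matrix_matrix_mult_def vec_eq_iff distrib_left distrib_right sum.distrib)
    show "A ** (c *\<^sub>R B) = c *\<^sub>R (A ** B)" "(c *\<^sub>R B) ** A = c *\<^sub>R (B ** A)"
      by (simp_all add: matrix_matrix_mult_def vec_eq_iff scaleR_sum_right)
  qed
  then show ?thesis
    by (rule bilinear_conv_bounded_bilinear[THEN iffD1])
qed

lemmas matrix_mult_simps =
  bounded_bilinear.diff_left[OF bounded_bilinear_matrix_matrix_mult]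
  bounded_bilinear.diff_right[OF bounded_bilinear_matrix_matrix_mult]
  bounded_bilinear.scaleR_left[OF bounded_bilinear_matrix_matrix_mult]
  bounded_bilinear.scaleR_right[OF bounded_bilinear_matrix_matrix_mult]

text \<open>The source of the coefficient functions \<open>c\<close> when the invariants of the flow
  are derived from \<open>linear_ode_zero\<close>.\<close>

lemma commutator_norm_bound:
  obtains K where "K > 0"
    "\<And>A B :: complex^'n^'n. norm (mat_commutator A B) \<le> K * norm A * norm B"
proof -
  obtain K where "K > 0" and K: "\<forall>(A :: complex^'n^'n) (B :: complex^'n^'n).
      norm (A ** B) \<le> norm A * norm B * K"
    using bounded_bilinear.pos_bounded[OF bounded_bilinear_matrix_matrix_mult] by blast
  show thesis
  proof (rule that)
    show "2 * K > 0"
      using \<open>K > 0\<close> by simp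
  next
    fix A B :: "complex^'n^'n"
    have "norm (mat_commutator A B) \<le> norm (A ** B) + norm (B ** A)"
      unfolding mat_commutator_def by (rule norm_triangle_ineq4)
    also have "\<dots> \<le> norm A * norm B * K + norm B * norm A * K"
      using K by (intro add_mono) blast+
    finally show "norm (mat_commutator A B) \<le> 2 * K * norm A * norm B"
      by (simp add: mult.commute mult.left_commute)
  qed
qed

lemma bounded_linear_trace: "bounded_linear (trace :: complex^'n^'n \<Rightarrow> complex)"
  unfolding linear_conv_bounded_linear[symmetric]
  by (auto intro!: linearI simp: trace_def sum.distrib scaleR_sum_right)

lemma bounded_linear_prediction:
  fixes \<rho> :: "complex^'n^'n"
  shows "bounded_linear (prediction \<rho>)"
proof -
  have "bounded_linear (\<lambda>A :: complex^'n^'n. Re (trace (\<rho> ** A)))"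
    using bounded_linear_compose[OF bounded_linear_Re
        bounded_linear_compose[OF bounded_linear_trace
          bounded_bilinear.bounded_linear_right[OF bounded_bilinear_matrix_matrix_mult, of \<rho>]]]
    by simp
  then show ?thesis
    by (simp add: prediction_def[abs_def])
qed

lemma bounded_linear_adjoint_mat: "bounded_linear (adjoint_mat :: complex^'n^'n \<Rightarrow> complex^'n^'n)"
  unfolding linear_conv_bounded_linear[symmetric]
  by (auto intro!: linearI simp: adjoint_mat_def vec_eq_iff)

lemma adjoint_mat_mult: "adjoint_mat (A ** B) = adjoint_mat B ** adjoint_mat A"
  by (simp add: adjoint_mat_def matrix_matrix_mult_def vec_eq_iff mult.commute)

lemma adjoint_mat_adjoint_mat [simp]: "adjoint_mat (adjoint_mat A) = A"
  by (simp add: adjoint_mat_def vec_eq_iff)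

lemma trace_adjoint_mat: "trace (adjoint_mat A) = cnj (trace A)"
  by (simp add: adjoint_mat_def trace_def)

text \<open>Taking adjoints reverses the order in each commutator, and the two resulting signs
  cancel. Hence the adjoint of a solution is again driven by a double commutator of the same
  form.\<close>

lemma adjoint_double_commutator:
  assumes "adjoint_mat \<rho> = \<rho>"
  shows "adjoint_mat (mat_commutator A (mat_commutator A \<rho>))
    = mat_commutator (adjoint_mat A) (mat_commutator (adjoint_mat A) \<rho>)"
proof -
  have "adjoint_mat (mat_commutator B C) = mat_commutator (adjoint_mat C) (adjoint_mat B)"
    for B C :: "complex^'a^'a"
    by (simp add: mat_commutator_def adjoint_mat_mult
        linear_diff[OF bounded_linear.linear[OF bounded_linear_adjoint_mat]])
  then show ?thesis
    by (simp add: assms) (simp add: mat_commutator_def matrix_mult_simps matrix_mul_assoc)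
qed

lemma trace_mult_adjoint_mat:
  assumes "adjoint_mat \<rho> = \<rho>"
  shows "trace (\<rho> ** adjoint_mat A) = cnj (trace (\<rho> ** A))"
  using trace_adjoint_mat[of "A ** \<rho>"] unfolding adjoint_mat_mult assms trace_mul_sym[of A \<rho>] .

section \<open>Traces against a rank-one projection\<close>

lemma pure_state_adjoint: "pure_state \<rho> \<Longrightarrow> adjoint_mat \<rho> = \<rho>"
  by (auto simp: pure_state_def adjoint_mat_def vec_eq_iff)

lemma pure_state_trace:
  assumes "pure_state \<rho>"
  shows "trace \<rho> = 1"
proof -
  obtain v :: "complex^'a" where v: "norm v = 1" "\<rho> = (\<chi> i j. v $ i * cnj (v $ j))"
    using assms by (auto simp: pure_state_def)
  have sum: "(\<Sum>i\<in>UNIV. (cmod (v $ i))\<^sup>2) = 1"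
    using v(1) by (simp add: norm_vec_def L2_set_def)
  have "trace \<rho> = (\<Sum>i\<in>UNIV. complex_of_real ((cmod (v $ i))\<^sup>2))"
    unfolding complex_norm_square by (simp add: v(2) trace_def)
  also have "\<dots> = complex_of_real (\<Sum>i\<in>UNIV. (cmod (v $ i))\<^sup>2)"
    by (rule of_real_sum[symmetric])
  finally show ?thesis
    unfolding sum by simp
qed

text \<open>For \<open>\<rho> = v v^dagger\<close> the product \<open>\<rho> A \<rho>\<close> is the
  scalar \<open>v^dagger A v = tr (\<rho> A)\<close> times \<open>\<rho>\<close>, so the trace
  factorizes.\<close>

lemma pure_state_trace_square:
  assumes "pure_state \<rho>"
  shows "trace (\<rho> ** A ** (\<rho> ** B)) = trace (\<rho> ** A) * trace (\<rho> ** B)"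
proof -
  obtain v :: "complex^'a" where v: "\<rho> = (\<chi> i j. v $ i * cnj (v $ j))"
    using assms by (auto simp: pure_state_def)
  \<comment> \<open>\<open>a C\<close> is the row vector \<open>v^dagger C\<close>, and
    \<open>\<rho> ** C\<close> is the outer product of \<open>v\<close> with it.\<close>
  define a where "a C l = (\<Sum>k\<in>UNIV. cnj (v $ k) * C $ k $ l)" for C :: "complex^'a^'a" and l
  have mult: "(\<rho> ** C) $ i $ l = v $ i * a C l" for C i l
    by (simp add: v a_def matrix_matrix_mult_def sum_distrib_left mult.assoc)
  have "trace (\<rho> ** A ** (\<rho> ** B)) = (\<Sum>i\<in>UNIV. \<Sum>l\<in>UNIV. (v $ i * a A l) * (v $ l * a B i))"
    unfolding trace_def matrix_matrix_mult_def[of "\<rho> ** A"] by (simp add: mult)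
  also have "\<dots> = (\<Sum>i\<in>UNIV. v $ i * a B i) * (\<Sum>l\<in>UNIV. v $ l * a A l)"
    unfolding sum_product by (simp add: ac_simps)
  finally show ?thesis
    unfolding trace_def by (simp add: mult ac_simps)
qed

text \<open>Expanding gives
  \<open>[A, [A, \<rho>]] = A A \<rho> - 2 A \<rho> A + \<rho> A A\<close>. Against
  \<open>\<rho>\<close>, each outer term contributes \<open>s tr (\<rho> \<rho>) = s\<close>, and
  the middle one factorizes into the squared trace.\<close>

lemma prediction_double_commutator:
  assumes \<rho>: "pure_state \<rho>" and herm: "adjoint_mat A = A"
    and square: "A ** A = s *\<^sub>R mat 1"
  shows "prediction \<rho> (mat_commutator A (mat_commutator A \<rho>)) = 2 * (s - (prediction \<rho> A)\<^sup>2)"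
proof -
  note tr = bounded_linear.linear[OF bounded_linear_trace]
  \<comment> \<open>Since \<open>A\<close> is Hermitian the trace is real, so passing to the real
    part in \<open>prediction\<close> loses nothing and commutes with squaring.\<close>
  have real: "trace (\<rho> ** A) = of_real (prediction \<rho> A)"
  proof -
    have "cnj (trace (\<rho> ** A)) = trace (\<rho> ** A)"
      using trace_mult_adjoint_mat[OF pure_state_adjoint[OF \<rho>], of A] herm by simp
    then show ?thesis
      by (simp add: prediction_def complex_eq_iff)
  qed
  have \<rho>\<rho>: "trace (\<rho> ** \<rho>) = 1"
    using pure_state_trace_square[OF \<rho>, of "mat 1" "mat 1"] pure_state_trace[OF \<rho>] by simp
  have "\<rho> ** mat_commutator A (mat_commutator A \<rho>)
      = \<rho> ** (A ** A) ** \<rho> - 2 *\<^sub>R (\<rho> ** A ** (\<rho> ** A)) + \<rho> ** \<rho> ** (A ** A)"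
    by (simp only: mat_commutator_def matrix_mult_simps matrix_mul_assoc scaleR_2)
      (simp add: algebra_simps)
  also have "\<dots> = (2 * s) *\<^sub>R (\<rho> ** \<rho>) - 2 *\<^sub>R (\<rho> ** A ** (\<rho> ** A))"
    unfolding square
    by (simp only: matrix_mult_simps matrix_mul_lid matrix_mul_rid mult_2 scaleR_add_left)
      (simp add: algebra_simps)
  finally have "trace (\<rho> ** mat_commutator A (mat_commutator A \<rho>))
      = (2 * s) *\<^sub>R trace (\<rho> ** \<rho>) - 2 *\<^sub>R trace (\<rho> ** A ** (\<rho> ** A))"
    by (simp add: linear_diff[OF tr] linear_scale[OF tr])
  also have "\<dots> = complex_of_real (2 * (s - (prediction \<rho> A)\<^sup>2))"
    unfolding pure_state_trace_square[OF \<rho>] \<rho>\<rho> real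
    by (simp add: scaleR_conv_of_real power2_eq_square algebra_simps)
  finally show ?thesis
    unfolding prediction_def[of _ "mat_commutator _ _"] by simp
qed

section \<open>Pauli measurements\<close>

text \<open>Distributivity: choosing a summation index separately at every tensor factor amounts to
  choosing one function \<open>m\<close> from factors to basis labels, which is a single index of
  the big matrix.\<close>

lemma tensor_mat_mult: "tensor_mat P ** tensor_mat Q = tensor_mat (\<lambda>k. P k ** Q k)"
proof -
  have "(\<Prod>k\<in>UNIV. \<Sum>c\<in>UNIV. P k $ i k $ c * Q k $ c $ j k)
      = (\<Sum>m\<in>UNIV. (\<Prod>k\<in>UNIV. P k $ i k $ m k) * (\<Prod>k\<in>UNIV. Q k $ m k $ j k))"
    for i j :: "'a \<Rightarrow> 2"
    by (subst prod_sum_PiE) (simp_all add: PiE_UNIV_domain prod.distrib)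
  then show ?thesis
    by (simp add: tensor_mat_def matrix_matrix_mult_def vec_eq_iff)
qed

lemma tensor_mat_one: "tensor_mat (\<lambda>k. mat 1) = mat 1"
proof -
  have "(\<Prod>k\<in>UNIV. if i k = j k then 1 else 0 :: complex) = (if i = j then 1 else 0)"
    for i j :: "'a \<Rightarrow> 2"
    by (auto simp: fun_eq_iff)
  then show ?thesis
    by (simp add: tensor_mat_def mat_def vec_eq_iff)
qed

lemma adjoint_tensor_mat: "adjoint_mat (tensor_mat P) = tensor_mat (\<lambda>k. adjoint_mat (P k))"
  by (simp add: adjoint_mat_def tensor_mat_def vec_eq_iff)

lemma pauli_square_adjoint:
  assumes "P \<in> {mat 1, pauli_X, pauli_Y, pauli_Z}"
  shows "P ** P = mat 1" "adjoint_mat P = P"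
  using assms
  by (auto simp: pauli_X_def pauli_Y_def pauli_Z_def adjoint_mat_def mat_def
      matrix_matrix_mult_def vec_eq_iff forall_2 sum_2)

lemma pauli_measurement_square_adjoint:
  assumes "pauli_measurement M"
  shows "M ** M = mat 1" "adjoint_mat M = M"
proof -
  obtain P where P: "\<And>k. P k \<in> {mat 1, pauli_X, pauli_Y, pauli_Z}" and M: "M = tensor_mat P"
    using assms by (auto simp: pauli_measurement_def)
  show "M ** M = mat 1" "adjoint_mat M = M"
    by (simp_all add: M tensor_mat_mult adjoint_tensor_mat pauli_square_adjoint[OF P] tensor_mat_one)
qed

section \<open>Invariants of the dynamics\<close>

text \<open>Telescoping of an expression quadratic in the matrix: each summand on the right contains
  \<open>A - B\<close> exactly once, so the difference of two solutions obeys a homogeneous linear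
  equation.\<close>

lemma double_commutator_diff:
  "mat_commutator A (mat_commutator A \<rho>) - mat_commutator B (mat_commutator B \<rho>)
    = mat_commutator (A - B) (mat_commutator A \<rho>) + mat_commutator B (mat_commutator (A - B) \<rho>)"
  by (simp only: mat_commutator_def matrix_mult_simps matrix_mul_assoc) (simp add: algebra_simps)

text \<open>The commutator with \<open>B\<close> is a derivation, here applied to
  \<open>A ** A\<close>; the multiple of the identity commutes with \<open>B\<close>. It is used
  with \<open>B = [M, \<rho>]\<close>.\<close>

lemma mat_commutator_square:
  "A ** mat_commutator A B + mat_commutator A B ** A = mat_commutator (A ** A - s *\<^sub>R mat 1) B"
  by (simp only: mat_commutator_def matrix_mult_simps matrix_mul_assoc matrix_mul_lid matrix_mul_rid)
    (simp add: algebra_simps)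

lemma asymptotic_dynamicsD:
  "asymptotic_dynamics \<rho> y M \<Longrightarrow> t \<ge> 0 \<Longrightarrow> (M has_vector_derivative
     (y - prediction \<rho> (M t)) *\<^sub>R mat_commutator (M t) (mat_commutator (M t) \<rho>)) (at t within {0..})"
  by (simp add: asymptotic_dynamics_def)

lemma asymptotic_dynamics_continuous:
  "asymptotic_dynamics \<rho> y M \<Longrightarrow> continuous_on {0..} M"
  by (auto simp: continuous_on_eq_continuous_within
      intro!: has_vector_derivative_continuous dest: asymptotic_dynamicsD)

lemma asymptotic_dynamics_prediction_continuous:
  "asymptotic_dynamics \<rho> y M \<Longrightarrow> continuous_on {0..} (\<lambda>t. prediction \<rho> (M t))"
  by (rule bounded_linear.continuous_on[OF bounded_linear_prediction asymptotic_dynamics_continuous])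

lemma continuous_on_commutator:
  fixes A B :: "real \<Rightarrow> complex^'n^'n"
  shows "continuous_on S A \<Longrightarrow> continuous_on S B \<Longrightarrow>
    continuous_on S (\<lambda>t. mat_commutator (A t) (B t))"
  unfolding mat_commutator_def
  by (intro continuous_on_diff bounded_bilinear.continuous_on[OF bounded_bilinear_matrix_matrix_mult])

text \<open>The adjoint of a solution solves the same equation, so this is uniqueness of solutions.\<close>

lemma asymptotic_dynamics_adjoint:
  assumes dyn: "asymptotic_dynamics \<rho> y M" and \<rho>: "adjoint_mat \<rho> = \<rho>"
    and init: "adjoint_mat (M 0) = M 0" and T: "0 \<le> T"
  shows "adjoint_mat (M T) = M T"
proof -
  obtain K where K: "K > 0"
    "\<And>A B :: complex^'a^'a. norm (mat_commutator A B) \<le> K * norm A * norm B"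
    using commutator_norm_bound by blast
  define r where "r t = y - prediction \<rho> (M t)" for t
  define A where "A t = adjoint_mat (M t)" for t
  define E where "E t = M t - A t" for t
  define E' where "E' t = r t *\<^sub>R (mat_commutator (E t) (mat_commutator (M t) \<rho>)
      + mat_commutator (A t) (mat_commutator (E t) \<rho>))" for t
  \<comment> \<open>The two summands estimate the two commutators in \<open>E'\<close>. Both depend
    on time only through the given solution \<open>M\<close>, which makes \<open>c\<close>
    continuous.\<close>
  define c where "c t = \<bar>r t\<bar> * (K * norm (mat_commutator (M t) \<rho>)
      + K * norm (A t) * (K * norm \<rho>))" for t
  note contM = asymptotic_dynamics_continuous[OF dyn]
  have contA: "continuous_on {0..} A"
    unfolding A_def by (rule bounded_linear.continuous_on[OF bounded_linear_adjoint_mat contM])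
  have "E T = 0"
  proof (rule linear_ode_zero[OF _ _ _ _ T])
    fix t :: real assume t: "t \<ge> 0"
    note M' = asymptotic_dynamicsD[OF dyn t]
    show "(E has_vector_derivative E' t) (at t within {0..})"
      unfolding E_def A_def
      by (rule has_vector_derivative_eq_rhs[OF has_vector_derivative_diff[OF M'
              bounded_linear.has_vector_derivative[OF bounded_linear_adjoint_mat M']]])
        (simp add: E'_def r_def E_def A_def adjoint_double_commutator[OF \<rho>]
          linear_scale[OF bounded_linear.linear[OF bounded_linear_adjoint_mat]]
          double_commutator_diff flip: scaleR_diff_right)
    have "norm (mat_commutator (E t) (mat_commutator (M t) \<rho>))
        \<le> K * norm (E t) * norm (mat_commutator (M t) \<rho>)"
      by (rule K(2))
    moreover have "norm (mat_commutator (A t) (mat_commutator (E t) \<rho>))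
        \<le> K * norm (A t) * norm (mat_commutator (E t) \<rho>)"
      by (rule K(2))
    moreover have "K * norm (A t) * norm (mat_commutator (E t) \<rho>)
        \<le> K * norm (A t) * (K * norm (E t) * norm \<rho>)"
      using K(1) by (intro mult_left_mono K(2)) simp
    ultimately have "norm (mat_commutator (E t) (mat_commutator (M t) \<rho>)
      + mat_commutator (A t) (mat_commutator (E t) \<rho>)) \<le> (K * norm (mat_commutator (M t) \<rho>)
      + K * norm (A t) * (K * norm \<rho>)) * norm (E t)"
      by (intro order_trans[OF norm_triangle_ineq]) (simp add: algebra_simps)
    then show "norm (E' t) \<le> c t * norm (E t)"
      unfolding E'_def c_def norm_scaleR mult.assoc[of "\<bar>r t\<bar>"] by (rule mult_left_mono) simp
  next
    show "continuous_on {0..} c"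
      unfolding c_def r_def
      by (intro continuous_intros continuous_on_commutator contM contA
          asymptotic_dynamics_prediction_continuous[OF dyn])
    show "E 0 = 0"
      by (simp add: E_def A_def init)
  qed
  then show ?thesis
    by (simp add: E_def A_def)
qed

text \<open>The equation is a Lax equation for \<open>r [M, \<rho>]\<close>, so that \<open>M\<^sup>2 - s\<close> also evolves by a
  commutator, which is linear in \<open>M\<^sup>2 - s\<close>.\<close>

lemma asymptotic_dynamics_square:
  assumes dyn: "asymptotic_dynamics \<rho> y M"
    and init: "M 0 ** M 0 = s *\<^sub>R mat 1" and T: "0 \<le> T"
  shows "M T ** M T = s *\<^sub>R mat 1"
proof -
  obtain K where K: "K > 0"
    "\<And>A B :: complex^'a^'a. norm (mat_commutator A B) \<le> K * norm A * norm B"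
    using commutator_norm_bound by blast
  define r where "r t = y - prediction \<rho> (M t)" for t
  define D where "D t = M t ** M t - s *\<^sub>R mat 1" for t
  define D' where "D' t = r t *\<^sub>R mat_commutator (D t) (mat_commutator (M t) \<rho>)" for t
  define c where "c t = \<bar>r t\<bar> * (K * norm (mat_commutator (M t) \<rho>))" for t
  have "D T = 0"
  proof (rule linear_ode_zero[OF _ _ _ _ T])
    fix t :: real assume t: "t \<ge> 0"
    note M' = asymptotic_dynamicsD[OF dyn t]
    show "(D has_vector_derivative D' t) (at t within {0..})"
      unfolding D_def
      by (rule has_vector_derivative_eq_rhs[OF has_vector_derivative_diff[OF
              bounded_bilinear.has_vector_derivative[OF bounded_bilinear_matrix_matrix_mult M' M']
              has_vector_derivative_const]])
        (simp add: D'_def r_def D_def matrix_mult_simps mat_commutator_square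
          flip: scaleR_add_right)
    have "norm (mat_commutator (D t) (mat_commutator (M t) \<rho>))
        \<le> K * norm (D t) * norm (mat_commutator (M t) \<rho>)"
      by (rule K(2))
    then have "\<bar>r t\<bar> * norm (mat_commutator (D t) (mat_commutator (M t) \<rho>))
        \<le> \<bar>r t\<bar> * (K * norm (D t) * norm (mat_commutator (M t) \<rho>))"
      by (rule mult_left_mono) simp
    then show "norm (D' t) \<le> c t * norm (D t)"
      by (simp add: D'_def c_def ac_simps)
  next
    show "continuous_on {0..} c"
      unfolding c_def r_def
      by (intro continuous_intros continuous_on_commutator asymptotic_dynamics_continuous[OF dyn]
          asymptotic_dynamics_prediction_continuous[OF dyn])
    show "D 0 = 0"
      by (simp add: D_def init)
  qed
  then show ?thesis
    by (simp add: D_def)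
qed

text \<open>The prediction is linear in the measurement, so it passes through the time derivative;
  the two invariants then allow the double commutator to be evaluated, leaving a scalar autonomous
  equation.\<close>

lemma asymptotic_dynamics_prediction:
  assumes dyn: "asymptotic_dynamics \<rho> y M" and \<rho>: "pure_state \<rho>"
    and herm: "adjoint_mat (M 0) = M 0" and square: "M 0 ** M 0 = s *\<^sub>R mat 1"
    and t: "t \<ge> 0"
  shows "((\<lambda>t. prediction \<rho> (M t)) has_real_derivative
    2 * (y - prediction \<rho> (M t)) * (s - (prediction \<rho> (M t))\<^sup>2)) (at t within {0..})"
proof -
  note linear = bounded_linear.linear[OF bounded_linear_prediction]
  have "prediction \<rho> (mat_commutator (M t) (mat_commutator (M t) \<rho>))
      = 2 * (s - (prediction \<rho> (M t))\<^sup>2)"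
    using asymptotic_dynamics_adjoint[OF dyn pure_state_adjoint[OF \<rho>] herm t]
      asymptotic_dynamics_square[OF dyn square t]
    by (rule prediction_double_commutator[OF \<rho>])
  then have "prediction \<rho> ((y - prediction \<rho> (M t)) *\<^sub>R
        mat_commutator (M t) (mat_commutator (M t) \<rho>))
      = 2 * (y - prediction \<rho> (M t)) * (s - (prediction \<rho> (M t))\<^sup>2)"
    by (simp only: linear_scale[OF linear] real_scaleR_def mult.assoc mult.left_commute)
  then show ?thesis
    unfolding has_real_derivative_iff_has_vector_derivative
    by (rule has_vector_derivative_eq_rhs[OF bounded_linear.has_vector_derivative[OF
            bounded_linear_prediction asymptotic_dynamicsD[OF dyn t]]])
qed

section \<open>Convergence\<close>

text \<open>The quantities \<open>y (y - p)\<close> and \<open>s - p\<^sup>2\<close> solve scalar homogeneous linear equations, hence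
  stay positive. The first one is therefore nonincreasing, which confines \<open>p\<close> to \<open>[-1, 1]\<close>.\<close>

lemma prediction_flow_bounded:
  fixes p :: "real \<Rightarrow> real"
  assumes deriv: "\<And>t. t \<ge> 0 \<Longrightarrow>
      (p has_real_derivative 2 * (y - p t) * (s - (p t)\<^sup>2)) (at t within {0..})"
    and y: "y \<in> {-1, 1}" and s: "s \<ge> 1" and init: "\<bar>p 0\<bar> < 1" and T: "0 \<le> T"
  shows "\<bar>p T\<bar> \<le> 1"
proof -
  have cont: "continuous_on {0..} p"
    using deriv by (auto intro!: DERIV_continuous_on)
  have "(p 0)\<^sup>2 < 1"
    using init by (simp add: abs_square_less_1)
  have gap: "s - (p t)\<^sup>2 > 0" if "0 \<le> t" for t
  proof (rule linear_ode_pos[OF _ _ _ that])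
    fix t :: real assume "t \<ge> 0"
    then show "((\<lambda>t. s - (p t)\<^sup>2) has_real_derivative (- 4 * p t * (y - p t)) * (s - (p t)\<^sup>2))
        (at t within {0..})"
      by (auto intro!: derivative_eq_intros deriv)
  next
    show "continuous_on {0..} (\<lambda>t. - 4 * p t * (y - p t))"
      by (intro continuous_intros cont)
    show "0 < s - (p 0)\<^sup>2"
      using s \<open>(p 0)\<^sup>2 < 1\<close> by simp
  qed
  \<comment> \<open>As \<open>y\<close> is a sign, \<open>z t = 1 - y * p t\<close>. This treats
    both labels at once, and the initial condition says \<open>0 < z 0 < 2\<close>.\<close>
  define z where "z t = y * (y - p t)" for t
  have z': "(z has_real_derivative (- 2 * (s - (p t)\<^sup>2)) * z t) (at t within {0..})"
    if "t \<ge> 0" for t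
    unfolding z_def using that by (auto intro!: derivative_eq_intros deriv simp: algebra_simps)
  have pos: "z t > 0" if "0 \<le> t" for t
  proof (rule linear_ode_pos[OF z' _ _ that])
    show "continuous_on {0..} (\<lambda>t. - 2 * (s - (p t)\<^sup>2))"
      by (intro continuous_intros cont)
    show "0 < z 0"
      using y init by (auto simp: z_def)
  qed
  \<comment> \<open>Gronwall with rate 0 is plain monotonicity. Together with positivity,
    \<open>0 < z T \<le> z 0 < 2\<close> places \<open>y * p T\<close> strictly between -1 and
    1.\<close>
  have "z T \<le> z 0 * exp (0 * T)"
  proof (rule differential_inequality_exp[OF T z'])
    show "(- 2 * (s - (p t)\<^sup>2)) * z t \<le> 0 * z t" if "0 \<le> t" for t
      using gap[OF that] pos[OF that] by (simp add: mult_nonpos_nonneg)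
  qed
  then show ?thesis
    using y init pos[OF T] by (auto simp: z_def)
qed

theorem corollary4p3:
  fixes \<rho> M\<^sub>0 U :: "complex^('q::finite \<Rightarrow> 2)^('q \<Rightarrow> 2)"
    and M :: "real \<Rightarrow> complex^('q \<Rightarrow> 2)^('q \<Rightarrow> 2)"
    and y \<gamma> :: real
  assumes "pure_state \<rho>"
    and "y \<in> {-1, 1}"
    and "\<gamma> > 1"
    and "pauli_measurement M\<^sub>0"
    and "unitary_mat U"
    and "M 0 = \<gamma> *\<^sub>R (adjoint_mat U ** M\<^sub>0 ** U)"
    and "asymptotic_dynamics \<rho> y M"
    and "\<bar>prediction \<rho> (M 0)\<bar> < 1"
  shows "\<exists>C\<^sub>1 \<ge> \<gamma>\<^sup>2 - 1. \<forall>t\<ge>0. objective \<rho> y (M t) \<le> objective \<rho> y (M 0) * exp (- C\<^sub>1 * t)"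
proof -
  define p where "p t = prediction \<rho> (M t)" for t
  have \<gamma>: "\<gamma>\<^sup>2 > 1"
    using assms(3) by (simp add: one_less_power)
  have herm: "adjoint_mat (M 0) = M 0"
    by (simp add: assms(6) linear_scale[OF bounded_linear.linear[OF bounded_linear_adjoint_mat]]
        adjoint_mat_mult pauli_measurement_square_adjoint[OF assms(4)] matrix_mul_assoc)
  \<comment> \<open>Unitary conjugation keeps the square of the Pauli measurement equal to the
    identity; the scaling then contributes \<open>\<gamma>\<close> twice.\<close>
  have "adjoint_mat U ** M\<^sub>0 ** U ** (adjoint_mat U ** M\<^sub>0 ** U)
      = adjoint_mat U ** M\<^sub>0 ** (U ** adjoint_mat U) ** M\<^sub>0 ** U"
    by (simp add: matrix_mul_assoc)
  also have "\<dots> = adjoint_mat U ** (M\<^sub>0 ** M\<^sub>0) ** U"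
    using assms(5) by (simp add: unitary_mat_def matrix_mul_assoc)
  also have "\<dots> = mat 1"
    using assms(5) by (simp add: unitary_mat_def pauli_measurement_square_adjoint[OF assms(4)])
  finally have square: "M 0 ** M 0 = \<gamma>\<^sup>2 *\<^sub>R mat 1"
    by (simp add: assms(6) matrix_mult_simps power2_eq_square)
  have p': "(p has_real_derivative 2 * (y - p t) * (\<gamma>\<^sup>2 - (p t)\<^sup>2)) (at t within {0..})"
    if "t \<ge> 0" for t
    unfolding p_def
    using asymptotic_dynamics_prediction[OF assms(7,1) herm square that] .
  \<comment> \<open>The rate 4 is a product of two factors 2: one from the double commutator, the
    other from the one half in the objective.\<close>
  have "(p t - y)\<^sup>2 / 2 \<le> (p 0 - y)\<^sup>2 / 2 * exp (- (4 * (\<gamma>\<^sup>2 - 1)) * t)" if "t \<ge> 0" for t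
  proof (rule differential_inequality_exp[OF that])
    fix u :: real assume "u \<ge> 0"
    then show "((\<lambda>t. (p t - y)\<^sup>2 / 2) has_real_derivative
        - 2 * (p u - y)\<^sup>2 * (\<gamma>\<^sup>2 - (p u)\<^sup>2)) (at u within {0..})"
      by (auto intro!: derivative_eq_intros p' simp: power2_eq_square field_simps)
  next
    fix u :: real assume u: "0 \<le> u"
    have "\<bar>p u\<bar> \<le> 1"
      using prediction_flow_bounded[OF p' assms(2) _ _ u] \<gamma> assms(8) by (simp add: p_def)
    then have "\<gamma>\<^sup>2 - 1 \<le> \<gamma>\<^sup>2 - (p u)\<^sup>2"
      by (simp add: abs_square_le_1)
    then have "(p u - y)\<^sup>2 * (\<gamma>\<^sup>2 - 1) \<le> (p u - y)\<^sup>2 * (\<gamma>\<^sup>2 - (p u)\<^sup>2)"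
      by (rule mult_left_mono) simp
    then show "- 2 * (p u - y)\<^sup>2 * (\<gamma>\<^sup>2 - (p u)\<^sup>2) \<le> - (4 * (\<gamma>\<^sup>2 - 1)) * ((p u - y)\<^sup>2 / 2)"
      by (simp add: algebra_simps)
  qed
  \<comment> \<open>The witness satisfies the required lower bound because
    \<open>\<gamma> > 1\<close> makes \<open>\<gamma>\<^sup>2 - 1\<close> positive.\<close>
  then show ?thesis
    using \<gamma> by (intro exI[of _ "4 * (\<gamma>\<^sup>2 - 1)"]) (simp add: objective_def p_def)
qed

end
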